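(* If $F_t=\{t f_i(x)+q_i : 1\le i\le N\}$ is a one-parameter affine, but not quasi-linear, family on $\mathbb{R}^d$, then there is a real number $\tau>0$ such that the attractor $A_t$ of $F_t$ is disconnected for all $t\in[0,\tau)$.
   Context: A function $f:\mathbb{R}^d\to\mathbb{R}^d$ is affine if $f(x)=Lx+a$, where $L$ is a non-singular $d\times d$ real matrix (the linear part of $f$) and $a\in\mathbb{R}^d$. A one-parameter affine family is given by $N\ge 2$ affine functions $F=\{f_1,\dots,f_N\}$ on $\mathbb{R}^d$ and vectors $q_1,\dots,q_N\in\mathbb{R}^d$; for each real $t\ge 0$ it is $F_t=\{f_{(i,t)} : 1\le i\le N\}$ with $f_{(i,t)}(x)=t f_i(x)+q_i$. The Hutchinson operator of $F_t$ on non-empty compact sets is $F_t(K)=\bigcup_{f\in F_t} f(K)$. A non-empty compact set $A_t$ is the attractor of $F_t$ if $A_t=\lim_{k\to\infty}F_t^k(K)$ in the Hausdorff metric for every non-empty compact $K$. If $L_1,\dots,L_N$ are the linear parts of $f_1,\dots,f_N$, the joint spectral radius of $F$ is $\rho(F)=\limsup_{k\to\infty}\big(\max\|L_{i_1}\cdots L_{i_k}\|\big)^{1/k}$, the maximum being over all words of length $k$ in $\{1,\dots,N\}$. Set $t_0=1/\rho(F)$; the attractor $A_t$ exists exactly for $t\in[0,t_0)$. Functions $f,g$ on $\mathbb{R}^d$ are conjugate by a function $h$ if $g=h^{-1}fh$. The family $F_t$ is quasi-linear if, for all $i$ and all $t\in[0,t_0)$, the function $f_{(i,t)}$ is conjugate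 to a linear function by a function $h_t$ that is independent of $i$.
   Formalization: Disconnectedness of A_t is not claimed at t = 0 when all q_i coincide: there A_0 is the single point q_1, hence connected, though the family may fail to be quasi-linear (e.g. f_1(x) = x, f_2(x) = x+1, q_1 = q_2 = 0 on the line). *)

theory Defs
  imports "HOL-Analysis.Analysis"
begin

definition affine_function :: "(real^'n \<Rightarrow> real^'n) \<Rightarrow> bool" where
  "affine_function f \<longleftrightarrow> (\<exists>L a. invertible L \<and> (\<forall>x. f x = L *v x + a))"

definition linear_part :: "(real^'n \<Rightarrow> real^'n) \<Rightarrow> real^'n^'n" where
  "linear_part f = (THE L. \<exists>a. \<forall>x. f x = L *v x + a)"

definition one_parameter_affine_family ::
    "nat \<Rightarrow> (nat \<Rightarrow> real^'n \<Rightarrow> real^'n) \<Rightarrow> (nat \<Rightarrow> real^'n) \<Rightarrow> bool" where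
  "one_parameter_affine_family N f q \<longleftrightarrow> 2 \<le> N \<and> (\<forall>i\<in>{1..N}. affine_function (f i))"

definition family_map ::
    "(nat \<Rightarrow> real^'n \<Rightarrow> real^'n) \<Rightarrow> (nat \<Rightarrow> real^'n) \<Rightarrow> nat \<Rightarrow> real \<Rightarrow> real^'n \<Rightarrow> real^'n" where
  "family_map f q i t x = t *\<^sub>R f i x + q i"

definition hutchinson ::
    "nat \<Rightarrow> (nat \<Rightarrow> real^'n \<Rightarrow> real^'n) \<Rightarrow> (nat \<Rightarrow> real^'n) \<Rightarrow> real
      \<Rightarrow> (real^'n) set \<Rightarrow> (real^'n) set" where
  "hutchinson N f q t K = (\<Union>i\<in>{1..N}. family_map f q i t ` K)"

(* This is the Hausdorff metric when restricted to non-empty compact sets, the only ones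
   to which it is applied below. *)
definition hausdorff_dist :: "'a::metric_space set \<Rightarrow> 'a set \<Rightarrow> real" where
  "hausdorff_dist A B = max (SUP a\<in>A. infdist a B) (SUP b\<in>B. infdist b A)"

(* For t = 0 the maps are the constants q i, so the attractor of F_0 is q ` {1..N}. It is a
   single point, hence connected, if all the q i coincide; this can happen for families that are
   not quasi-linear, e.g. f_1(x) = x, f_2(x) = x + 1, q_1 = q_2 = 0 on the line. *)
definition is_attractor ::
    "nat \<Rightarrow> (nat \<Rightarrow> real^'n \<Rightarrow> real^'n) \<Rightarrow> (nat \<Rightarrow> real^'n) \<Rightarrow> real \<Rightarrow> (real^'n) set \<Rightarrow> bool" where
  "is_attractor N f q t A \<longleftrightarrow> compact A \<and> A \<noteq> {} \<and>
     (\<forall>K. compact K \<and> K \<noteq> {} \<longrightarrow>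
        (\<lambda>k. hausdorff_dist ((hutchinson N f q t ^^ k) K) A) \<longlonglongrightarrow> 0)"

definition word_matrix :: "(nat \<Rightarrow> real^'n \<Rightarrow> real^'n) \<Rightarrow> nat list \<Rightarrow> real^'n^'n" where
  "word_matrix f w = foldr (\<lambda>i M. linear_part (f i) ** M) w (mat 1)"

(* Any matrix norm gives the same joint spectral radius; here it is the operator norm induced by
   the Euclidean norm. The limsup is taken in the extended reals. *)
definition joint_spectral_radius :: "nat \<Rightarrow> (nat \<Rightarrow> real^'n \<Rightarrow> real^'n) \<Rightarrow> ereal" where
  "joint_spectral_radius N f = limsup (\<lambda>k. ereal (root k
     (Max ((\<lambda>w. onorm ((*v) (word_matrix f w))) ` {w. length w = k \<and> set w \<subseteq> {1..N}}))))"

definition existence_threshold :: "nat \<Rightarrow> (nat \<Rightarrow> real^'n \<Rightarrow> real^'n) \<Rightarrow> ereal" where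
  "existence_threshold N f = 1 / joint_spectral_radius N f"

definition conjugate_by :: "('a \<Rightarrow> 'a) \<Rightarrow> ('a \<Rightarrow> 'a) \<Rightarrow> ('a \<Rightarrow> 'a) \<Rightarrow> bool" where
  "conjugate_by h f g \<longleftrightarrow> bij h \<and> g = inv h \<circ> f \<circ> h"

definition quasi_linear ::
    "nat \<Rightarrow> (nat \<Rightarrow> real^'n \<Rightarrow> real^'n) \<Rightarrow> (nat \<Rightarrow> real^'n) \<Rightarrow> bool" where
  "quasi_linear N f q \<longleftrightarrow>
     (\<forall>t\<ge>0. ereal t < existence_threshold N f \<longrightarrow>
        (\<exists>h. \<forall>i\<in>{1..N}. \<exists>g. linear g \<and> conjugate_by h (family_map f q i t) g))"

end

theory Submission
  imports Defs
begin

text \<open>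
  Write \<open>f\<^sub>i x = L\<^sub>i x + a\<^sub>i\<close>. For small \<open>t\<close> the maps of \<open>F\<^sub>t\<close> are contractions with a common
  ratio, so \<open>F\<^sub>t\<close> has a compact set \<open>A\<close> with \<open>F\<^sub>t(A) = A\<close>, which is the attractor. The set \<open>A\<close> is
  the union of its pieces \<open>t f\<^sub>i(A) + q\<^sub>i\<close>, and the piece with index \<open>i\<close> lies in a ball about \<open>q\<^sub>i\<close>
  whose radius is \<open>O(t)\<close>. If the \<open>q\<^sub>i\<close> are not all equal, the pieces therefore separate for all
  sufficiently small \<open>t\<close> (\<open>invariant_disconnected_if_translations_differ\<close>).

  If all \<open>q\<^sub>i\<close> are the same point \<open>c\<close>, the attractor shrinks to \<open>c\<close> as \<open>t\<close> tends to \<open>0\<close>, and it has to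
  be magnified. For \<open>t > 0\<close> the substitution \<open>x = c + t w\<close> turns the family into \<open>t L\<^sub>i w + f\<^sub>i c\<close>
  (\<open>disconnected_for_small_t_rescale\<close>), which is of the same type with the new translation vectors
  \<open>f\<^sub>i c\<close>. If these are again equal to one vector \<open>b\<close>, a further magnification gives the vectors
  \<open>L\<^sub>i b\<close>, and so on. If two vectors differ at some stage, the attractor is disconnected for all
  sufficiently small \<open>t > 0\<close>.

  If the vectors agree at every stage, then all \<open>L\<^sub>i\<close> act in the same way on the orbit of \<open>b\<close> under
  \<open>L\<^sub>1\<close>, hence on its span \<open>V\<close>, which \<open>L\<^sub>1\<close> maps into itself. For \<open>t > 0\<close> below the existence
  threshold, \<open>1 / t\<close> is not an eigenvalue of \<open>L\<^sub>1\<close>, so \<open>I - t L\<^sub>1\<close> is injective, and it maps the finite-dimensional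
  space \<open>V\<close> onto itself. The solution \<open>v\<close> in \<open>V\<close> of \<open>v - t L\<^sub>1 v = t b\<close> makes \<open>c + v\<close> a common fixed
  point of all maps of \<open>F\<^sub>t\<close>, and moving this point to the origin makes all of them linear
  (\<open>quasi_linear_if_orbit_common\<close>). The family is then quasi-linear. So for a family that is not
  quasi-linear, some stage separates the pieces.
\<close>

section \<open>Attractors of finite families of contractions\<close>

text \<open>
  Let \<open>H\<close> send a set to the union of its images under the maps. The orbit \<open>E\<close> of a fixed point \<open>p\<close> of
  one of the maps under all finite compositions satisfies \<open>H(E) = E\<close>, since \<open>p\<close> is itself an image.
  It is bounded, and its closure is the required set: \<open>H\<close> of the closure is compact and contains \<open>E\<close>.
\<close>

lemma contractions_invariant_compact_exists:
  fixes g :: "'i \<Rightarrow> 'a::heine_borel \<Rightarrow> 'a"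
  assumes I: "finite I" "j \<in> I" and r: "0 \<le> r" "r < 1"
    and contr: "\<And>i x y. i \<in> I \<Longrightarrow> dist (g i x) (g i y) \<le> r * dist x y"
  obtains A where "compact A" "A \<noteq> {}" "(\<Union>i\<in>I. g i ` A) = A"
proof -
  define H where "H K = (\<Union>i\<in>I. g i ` K)" for K
  have cont: "continuous_on S (g i)" if "i \<in> I" for i S
  proof (rule lipschitz_on_continuous_on)
    show "r-lipschitz_on S (g i)" using contr[OF that] r(1) by (intro lipschitz_onI)
  qed
  obtain p where p: "g j p = p"
    using banach_fix_type[OF r] contr[OF I(2)] by blast
  define E where "E = (\<Union>k. (H ^^ k) {p})"
  have HE: "H E = E"
  proof
    have "g i x \<in> E" if i: "i \<in> I" and x: "x \<in> E" for i x
    proof -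
      obtain k where "x \<in> (H ^^ k) {p}" using x by (auto simp: E_def)
      hence "g i x \<in> (H ^^ Suc k) {p}" using i by (auto simp: H_def)
      thus ?thesis unfolding E_def by blast
    qed
    thus "H E \<subseteq> E" by (auto simp: H_def)
    have "x \<in> H E" if x: "x \<in> (H ^^ k) {p}" for x k
    proof (cases k)
      case 0
      have "p \<in> E" unfolding E_def by (rule UN_I[of 0]) auto
      hence "g j p \<in> H E" using I(2) by (auto simp: H_def)
      thus ?thesis using 0 x p by simp
    next
      case (Suc k')
      hence "x \<in> H ((H ^^ k') {p})" using x by simp
      then obtain i y where "i \<in> I" "y \<in> (H ^^ k') {p}" "x = g i y"
        unfolding H_def[of "(H ^^ k') {p}"] by blast
      moreover from this(2) have "y \<in> E" unfolding E_def by blast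
      ultimately show ?thesis unfolding H_def[of E] by blast
    qed
    thus "E \<subseteq> H E" by (auto simp: E_def)
  qed
  \<comment> \<open>The radius \<open>R\<close> solves \<open>r R + D = R\<close>, so every \<open>g i\<close> maps the ball of radius \<open>R\<close> about \<open>p\<close> into itself.\<close>
  define D where "D = (\<Sum>i\<in>I. dist (g i p) p)"
  define R where "R = D / (1 - r)"
  have D: "dist (g i p) p \<le> D" if "i \<in> I" for i
    unfolding D_def using member_le_sum[OF that, of "\<lambda>i. dist (g i p) p"] I(1) by simp
  have "(1 - r) * R = D" using r by (simp add: R_def)
  hence R: "r * R + D = R" by (simp add: algebra_simps)
  have R0: "0 \<le> R" using r by (simp add: R_def D_def sum_nonneg)
  have "dist x p \<le> R" if "x \<in> (H ^^ k) {p}" for x k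
    using that
  proof (induction k arbitrary: x)
    case 0
    thus ?case using R0 by simp
  next
    case (Suc k)
    from Suc.prems have "x \<in> H ((H ^^ k) {p})" by simp
    then obtain i y where i: "i \<in> I" and y: "y \<in> (H ^^ k) {p}" and x: "x = g i y"
      unfolding H_def[of "(H ^^ k) {p}"] by blast
    have "dist x p \<le> dist (g i y) (g i p) + dist (g i p) p"
      unfolding x by (rule dist_triangle)
    also have "\<dots> \<le> r * dist y p + D"
      using contr[OF i, of y p] D[OF i] by linarith
    also have "\<dots> \<le> r * R + D"
      using Suc.IH[OF y] r by (simp add: mult_left_mono)
    finally show ?case using R by simp
  qed
  hence "bounded E"
    by (auto simp: E_def bounded_def dist_commute intro!: exI[of _ p] exI[of _ R])
  hence cE: "compact (closure E)" by simp
  have "H (closure E) = closure E"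
  proof
    have "g i ` closure E \<subseteq> closure E" if "i \<in> I" for i
    proof (rule image_closure_subset)
      show "g i ` E \<subseteq> closure E"
        using HE that closure_subset by (fastforce simp: H_def)
    qed (use cont[OF that] in auto)
    thus "H (closure E) \<subseteq> closure E" by (auto simp: H_def)
    have "compact (H (closure E))"
      unfolding H_def using I(1) cont cE by (intro compact_UN compact_continuous_image) auto
    moreover have "H E \<subseteq> H (closure E)"
      using closure_subset by (fastforce simp: H_def)
    ultimately show "closure E \<subseteq> H (closure E)"
      using HE by (intro closure_minimal compact_imp_closed) auto
  qed
  moreover have "p \<in> E" unfolding E_def by (rule UN_I[of 0]) auto
  ultimately show ?thesis using that[of "closure E"] cE closure_subset by (auto simp: H_def)
qed

text \<open>
  The real \<open>SUP\<close> is an upper bound only of a set that is bounded above. Hence even nonnegativity rests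
  on the hypotheses, which bound the distance functions.
\<close>

lemma hausdorff_dist_le:
  assumes "A \<noteq> {}" "B \<noteq> {}"
    and AB: "\<And>a. a \<in> A \<Longrightarrow> \<exists>b\<in>B. dist a b \<le> e"
    and BA: "\<And>b. b \<in> B \<Longrightarrow> \<exists>a\<in>A. dist a b \<le> e"
  shows "0 \<le> hausdorff_dist A B" "hausdorff_dist A B \<le> e"
proof -
  have 1: "infdist a B \<le> e" if "a \<in> A" for a
    using AB[OF that] infdist_le2 by blast
  have 2: "infdist b A \<le> e" if "b \<in> B" for b
    using BA[OF that] infdist_le2 by (metis dist_commute)
  show "hausdorff_dist A B \<le> e"
    unfolding hausdorff_dist_def using 1 2 assms(1,2) by (auto intro!: cSUP_least)
  obtain a where a: "a \<in> A" using assms(1) by blast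
  have "infdist a B \<le> (SUP a\<in>A. infdist a B)"
    using 1 a by (intro cSUP_upper) (auto simp: bdd_above_def)
  thus "0 \<le> hausdorff_dist A B"
    unfolding hausdorff_dist_def using infdist_nonneg[of a B] by linarith
qed

text \<open>
  If each point of one of two sets is within \<open>e\<close> of a point of the other, then the images of the two
  sets under \<open>H\<close> have this property with \<open>r e\<close>, because partners can be mapped by the same \<open>g i\<close>.
  As \<open>H\<close> fixes \<open>A\<close>, the distance from \<open>H\<^sup>k K\<close> to \<open>A\<close> is at most \<open>r\<^sup>k\<close> times the initial bound.
\<close>

lemma contractions_iterates_tendsto_invariant:
  fixes g :: "'i \<Rightarrow> 'a::metric_space \<Rightarrow> 'a" and I :: "'i set"
  defines "H \<equiv> \<lambda>K. \<Union>i\<in>I. g i ` K"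
  assumes r: "0 \<le> r" "r < 1"
    and contr: "\<And>i x y. i \<in> I \<Longrightarrow> dist (g i x) (g i y) \<le> r * dist x y"
    and A: "compact A" "A \<noteq> {}" "H A = A"
    and K: "compact K" "K \<noteq> {}"
  shows "(\<lambda>k. hausdorff_dist ((H ^^ k) K) A) \<longlonglongrightarrow> 0"
proof -
  define D where "D = diameter (K \<union> A)"
  have D: "dist x y \<le> D" if "x \<in> K" "y \<in> A" for x y
    unfolding D_def using A(1) K(1) that
    by (intro diameter_bounded_bound) (auto simp: compact_imp_bounded)
  have Suc_H: "(H ^^ Suc k) K = (\<Union>i\<in>I. g i ` (H ^^ k) K)" for k by (simp add: H_def)
  have A_image: "g i y \<in> A" if "i \<in> I" "y \<in> A" for i y
    using A(3) that by (auto simp: H_def)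
  have A_preimage: "\<exists>i\<in>I. \<exists>z\<in>A. y = g i z" if "y \<in> A" for y
  proof -
    have "y \<in> H A" using A(3) that by simp
    thus ?thesis by (auto simp: H_def)
  qed
  have contr': "dist (g i x) (g i y) \<le> r ^ Suc k * D" if "i \<in> I" "dist x y \<le> r ^ k * D" for i x y k
    using contr[OF that(1), of x y] mult_left_mono[OF that(2) r(1)] by (simp add: mult.assoc)
  have to_A: "\<exists>y\<in>A. dist x y \<le> r ^ k * D" if "x \<in> (H ^^ k) K" for x k
    using that
  proof (induction k arbitrary: x)
    case 0
    thus ?case using D A(2) by fastforce
  next
    case (Suc k)
    then obtain i z where "i \<in> I" "z \<in> (H ^^ k) K" "x = g i z"
      unfolding Suc_H by blast
    moreover then obtain y where "y \<in> A" "dist z y \<le> r ^ k * D" using Suc.IH by blast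
    ultimately show ?case using contr' A_image by blast
  qed
  have from_A: "\<exists>x\<in>(H ^^ k) K. dist x y \<le> r ^ k * D" if "y \<in> A" for y k
    using that
  proof (induction k arbitrary: y)
    case 0
    thus ?case using D K(2) by fastforce
  next
    case (Suc k)
    then obtain i z where "i \<in> I" "z \<in> A" "y = g i z" using A_preimage by blast
    moreover then obtain x where "x \<in> (H ^^ k) K" "dist x z \<le> r ^ k * D" using Suc.IH by blast
    ultimately show ?case using contr' unfolding Suc_H by blast
  qed
  have "(H ^^ k) K \<noteq> {}" for k using from_A A(2) by blast
  hence bounds: "0 \<le> hausdorff_dist ((H ^^ k) K) A" "hausdorff_dist ((H ^^ k) K) A \<le> r ^ k * D" for k
    using hausdorff_dist_le[of "(H ^^ k) K" A "r ^ k * D"] A(2) to_A from_A by auto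
  have "(\<lambda>k. r ^ k * D) \<longlonglongrightarrow> 0 * D"
    using r by (intro tendsto_mult LIMSEQ_realpow_zero tendsto_const) auto
  thus ?thesis
    using bounds by (auto intro: Lim_null_comparison[rotated, of "\<lambda>k. r ^ k * D"])
qed

section \<open>Separation for small parameters\<close>

lemma finite_linear_common_bound:
  fixes L :: "'i \<Rightarrow> 'a::euclidean_space \<Rightarrow> 'b::real_normed_vector"
  assumes "finite I" "\<And>i. i \<in> I \<Longrightarrow> linear (L i)"
  shows "\<exists>M>0. \<forall>i\<in>I. \<forall>x. norm (L i x) \<le> M * norm x"
proof (intro exI conjI ballI allI)
  have bl: "bounded_linear (L i)" if "i \<in> I" for i
    using assms(2)[OF that] by (rule linear_conv_bounded_linear[THEN iffD1])
  define M where "M = (\<Sum>i\<in>I. onorm (L i)) + 1"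
  have nonneg: "0 \<le> onorm (L i)" if "i \<in> I" for i using bl[OF that] by (rule onorm_pos_le)
  show "M > 0"
    unfolding M_def using nonneg by (intro add_nonneg_pos sum_nonneg) auto
  fix i and x :: 'a assume i: "i \<in> I"
  have "onorm (L i) \<le> (\<Sum>i\<in>I. onorm (L i))"
    using assms(1) i nonneg by (intro member_le_sum) auto
  hence "onorm (L i) * norm x \<le> M * norm x"
    by (intro mult_right_mono) (auto simp: M_def)
  thus "norm (L i x) \<le> M * norm x"
    using onorm[OF bl[OF i], of x] by linarith
qed

text \<open>
  Let \<open>M\<close> bound the linear parts and \<open>C\<close> the vectors \<open>a i\<close> and \<open>c i\<close>. A point of largest norm in
  an invariant set is an image of a point of the set. For \<open>t \<le> 1 / (2 M)\<close> and \<open>t \<le> 1\<close> this bounds the norm on the set by \<open>4 C\<close>, independently of \<open>t\<close>. Hence the piece with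
  index \<open>i\<close> lies within \<open>t B\<close> of \<open>c i\<close>. When \<open>t B\<close> is less than half the distance \<open>d\<close> from \<open>c 1\<close> to
  the other translation vectors, the sphere of radius \<open>d / 2\<close> about \<open>c 1\<close> misses the set and has
  points of the set on both sides.
\<close>

lemma invariant_disconnected_if_translations_differ:
  fixes f :: "nat \<Rightarrow> real^'n \<Rightarrow> real^'n"
  assumes lin: "\<And>i. i \<in> {1..N} \<Longrightarrow> linear (L i)"
    and f: "\<And>i x. i \<in> {1..N} \<Longrightarrow> f i x = L i x + a i"
    and j: "j \<in> {1..N}" "c j \<noteq> c 1"
  obtains \<tau> where "\<tau> > 0"
    "\<And>t A. \<lbrakk>0 \<le> t; t < \<tau>; compact A; A \<noteq> {}; hutchinson N f c t A = A\<rbrakk> \<Longrightarrow> \<not> connected A"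
proof -
  obtain M where M: "M > 0" and LM: "\<forall>i\<in>{1..N}. \<forall>x. norm (L i x) \<le> M * norm x"
    using finite_linear_common_bound[of "{1..N}" L] lin by auto
  note M = M LM[rule_format]
  define C where "C = (\<Sum>i\<in>{1..N}. norm (a i)) + (\<Sum>i\<in>{1..N}. norm (c i))"
  have C: "norm (a i) \<le> C" "norm (c i) \<le> C" if "i \<in> {1..N}" for i
  proof -
    have "norm (a i) \<le> (\<Sum>i\<in>{1..N}. norm (a i))" "norm (c i) \<le> (\<Sum>i\<in>{1..N}. norm (c i))"
      using member_le_sum[OF that, of "\<lambda>i. norm (a i)"] member_le_sum[OF that, of "\<lambda>i. norm (c i)"]
      by simp_all
    thus "norm (a i) \<le> C" "norm (c i) \<le> C"
      unfolding C_def by (simp_all add: add_increasing add_increasing2 sum_nonneg)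
  qed
  have C0: "0 \<le> C" by (simp add: C_def sum_nonneg)
  obtain d where d: "d > 0" "\<And>i. i \<in> {1..N} \<Longrightarrow> c i \<noteq> c 1 \<Longrightarrow> d \<le> dist (c 1) (c i)"
    using finite_set_avoid[of "c ` {1..N}" "c 1"] by auto
  \<comment> \<open>\<open>4 C\<close> will bound the norm on the invariant set; the summand \<open>1\<close> makes \<open>B\<close> positive.\<close>
  define B where "B = M * (4 * C) + C + 1"
  have B: "B > 0" unfolding B_def using M C0 by (simp add: add_nonneg_pos)
  define \<tau> where "\<tau> = min (min 1 (1 / (2 * M))) (d / (2 * B))"
  show ?thesis
  proof
    show "\<tau> > 0" using d M B by (simp add: \<tau>_def)
    fix t A
    assume t: "0 \<le> t" "t < \<tau>" and A: "compact A" "A \<noteq> {}" "hutchinson N f c t A = A"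
    have t1: "t \<le> 1" "t * M \<le> 1 / 2" "t * B < d / 2"
      using t M B by (auto simp: \<tau>_def field_simps)
    have image: "family_map f c i t x \<in> A" if "i \<in> {1..N}" "x \<in> A" for i x
    proof -
      have "family_map f c i t x \<in> hutchinson N f c t A"
        unfolding hutchinson_def using that by blast
      thus ?thesis using A(3) by simp
    qed
    have preimage: "\<exists>i\<in>{1..N}. \<exists>y\<in>A. x = family_map f c i t y" if "x \<in> A" for x
    proof -
      have "x \<in> hutchinson N f c t A" using that A(3) by simp
      thus ?thesis unfolding hutchinson_def by blast
    qed
    have near: "norm (family_map f c i t y - c i) \<le> t * (M * norm y + C)"
      if "i \<in> {1..N}" for i y
    proof -
      have "norm (f i y) \<le> M * norm y + C"
        using M(2)[OF that, of y] C[OF that] norm_triangle_ineq[of "L i y" "a i"] f[OF that]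
        by simp
      thus ?thesis using t(1) by (simp add: family_map_def mult_left_mono)
    qed
    obtain x where x: "x \<in> A" "\<And>y. y \<in> A \<Longrightarrow> norm y \<le> norm x"
      using continuous_attains_sup[OF A(1,2), of norm] by (auto intro: continuous_intros)
    obtain i y where iy: "i \<in> {1..N}" "y \<in> A" "x = family_map f c i t y"
      using preimage[OF x(1)] by blast
    have "norm x \<le> t * (M * norm y + C) + C"
      using near[OF iy(1), of y] C(2)[OF iy(1)] norm_triangle_sub[of x "c i"]
      unfolding iy(3) by linarith
    also have "\<dots> = (t * M) * norm y + t * C + C" by (simp add: algebra_simps)
    also have "\<dots> \<le> 1 / 2 * norm x + 1 * C + C"
      using t1 t(1) M(1) C0 x(2)[OF iy(2)] by (intro add_mono mult_mono) auto
    finally have R: "norm y \<le> 4 * C" if "y \<in> A" for y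
      using x(2)[OF that] by linarith
    have close: "dist (c i) (family_map f c i t y) < d / 2" if "i \<in> {1..N}" "y \<in> A" for i y
    proof -
      have "t * (M * norm y + C) \<le> t * B"
        unfolding B_def using t(1) R[OF that(2)] M(1)
        by (intro mult_left_mono) (auto intro!: add_increasing2[of 1] mult_left_mono)
      thus ?thesis using near[OF that(1), of y] t1 by (simp add: dist_norm norm_minus_commute)
    qed
    have far: "d / 2 < dist (c 1) (family_map f c i t y)"
      if "i \<in> {1..N}" "y \<in> A" "c i \<noteq> c 1" for i y
      using close[OF that(1,2)] d(2)[OF that(1,3)]
        dist_triangle2[of "c 1" "c i" "family_map f c i t y"] by linarith
    obtain y where y: "y \<in> A" using A(2) by blast
    have one: "1 \<in> {1..N}" using j(1) by auto
    show "\<not> connected A"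
    proof
      assume "connected A"
      moreover have "A \<subseteq> ball (c 1) (d / 2) \<union> - cball (c 1) (d / 2)"
      proof
        fix x assume "x \<in> A"
        then obtain i z where "i \<in> {1..N}" "z \<in> A" "x = family_map f c i t z"
          using preimage by blast
        thus "x \<in> ball (c 1) (d / 2) \<union> - cball (c 1) (d / 2)"
          using close[of i z] far[of i z] by (cases "c i = c 1") auto
      qed
      moreover have "family_map f c 1 t y \<in> ball (c 1) (d / 2) \<inter> A"
        using close[OF one y] image[OF one y] by simp
      moreover have "family_map f c j t y \<in> - cball (c 1) (d / 2) \<inter> A"
        using far[OF j(1) y j(2)] image[OF j(1) y] by simp
      moreover have "ball (c 1) (d / 2) \<inter> - cball (c 1) (d / 2) \<inter> A = {}" by auto
      ultimately show False
        using connectedD[of A "ball (c 1) (d / 2)" "- cball (c 1) (d / 2)"]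
        by (auto simp: open_Compl)
    qed
  qed
qed

text \<open>
  The value \<open>t = 0\<close> is left out: the magnification by \<open>1 / t\<close> needs \<open>t > 0\<close>, and with equal translation
  vectors the invariant set for \<open>t = 0\<close> is a single point.
\<close>

definition disconnected_for_small_t ::
    "nat \<Rightarrow> (nat \<Rightarrow> real^'n \<Rightarrow> real^'n) \<Rightarrow> (nat \<Rightarrow> real^'n) \<Rightarrow> bool" where
  "disconnected_for_small_t N f c \<longleftrightarrow> (\<exists>\<tau>>0. \<forall>t\<in>{0<..<\<tau>}. \<forall>A.
     compact A \<and> A \<noteq> {} \<and> hutchinson N f c t A = A \<longrightarrow> \<not> connected A)"

lemma disconnected_for_small_t_cong:
  assumes "\<And>i. i \<in> {1..N} \<Longrightarrow> c i = c' i"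
  shows "disconnected_for_small_t N f c = disconnected_for_small_t N f c'"
proof -
  have "hutchinson N f c = hutchinson N f c'"
    using assms by (auto simp: fun_eq_iff hutchinson_def family_map_def)
  thus ?thesis by (simp add: disconnected_for_small_t_def)
qed

text \<open>
  The map \<open>k x = (x - c) / t\<close> conjugates \<open>t f\<^sub>i x + c\<close> to \<open>t L\<^sub>i w + f\<^sub>i c\<close>, because
  \<open>f\<^sub>i (c + t w) = t L\<^sub>i w + f\<^sub>i c\<close>. It carries invariant sets to invariant sets and preserves
  connectedness.
\<close>

lemma disconnected_for_small_t_rescale:
  fixes f :: "nat \<Rightarrow> real^'n \<Rightarrow> real^'n"
  assumes lin: "\<And>i. i \<in> {1..N} \<Longrightarrow> linear (L i)"
    and f: "\<And>i x. i \<in> {1..N} \<Longrightarrow> f i x = L i x + a i"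
    and dis: "disconnected_for_small_t N L (\<lambda>i. f i c)"
  shows "disconnected_for_small_t N f (\<lambda>_. c)"
proof -
  let ?c' = "\<lambda>i. f i c"
  obtain \<tau> where \<tau>: "\<tau> > 0" and dis': "\<And>t A. \<lbrakk>0 < t; t < \<tau>; compact A; A \<noteq> {};
      hutchinson N L ?c' t A = A\<rbrakk> \<Longrightarrow> \<not> connected A"
    using dis unfolding disconnected_for_small_t_def by (metis greaterThanLessThan_iff)
  have "\<not> connected A"
    if t: "0 < t" "t < \<tau>" and A: "compact A" "A \<noteq> {}" "hutchinson N f (\<lambda>_. c) t A = A" for t A
  proof
    assume conn: "connected A"
    define k where "k x = (1 / t) *\<^sub>R (x - c)" for x
    have cont: "continuous_on A k" unfolding k_def by (intro continuous_intros)
    have conj: "k (family_map f (\<lambda>_. c) i t x) = family_map L ?c' i t (k x)" if i: "i \<in> {1..N}" for i x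
    proof -
      have "f i x - f i c = t *\<^sub>R L i (k x)"
        using t lin[OF i] f[OF i] by (simp add: k_def linear_diff linear_scale)
      hence "f i x = t *\<^sub>R L i (k x) + f i c" by (simp add: algebra_simps)
      thus ?thesis using t by (simp add: family_map_def k_def)
    qed
    have "hutchinson N L ?c' t (k ` A) = k ` hutchinson N f (\<lambda>_. c) t A"
      unfolding hutchinson_def image_UN image_image using conj by simp
    hence "hutchinson N L ?c' t (k ` A) = k ` A" using A(3) by simp
    moreover have "compact (k ` A)" "connected (k ` A)"
      using A(1) conn cont by (auto intro: compact_continuous_image connected_continuous_image)
    ultimately show False using dis'[OF t, of "k ` A"] A(2) by simp
  qed
  hence "\<forall>t\<in>{0<..<\<tau>}. \<forall>A. compact A \<and> A \<noteq> {} \<and> hutchinson N f (\<lambda>_. c) t A = A \<longrightarrow> \<not> connected A"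
    by (metis greaterThanLessThan_iff)
  thus ?thesis unfolding disconnected_for_small_t_def using \<tau> by blast
qed

lemma disconnected_for_small_t_if_translations_differ:
  fixes f :: "nat \<Rightarrow> real^'n \<Rightarrow> real^'n"
  assumes lin: "\<And>i. i \<in> {1..N} \<Longrightarrow> linear (L i)"
    and f: "\<And>i x. i \<in> {1..N} \<Longrightarrow> f i x = L i x + a i"
    and j: "j \<in> {1..N}" "c j \<noteq> c 1"
  shows "disconnected_for_small_t N f c"
proof -
  obtain \<tau> where \<tau>: "\<tau> > 0" and dis:
    "\<And>t A. \<lbrakk>0 \<le> t; t < \<tau>; compact A; A \<noteq> {}; hutchinson N f c t A = A\<rbrakk> \<Longrightarrow> \<not> connected A"
    by (rule invariant_disconnected_if_translations_differ[where f = f and L = L and a = a and c = c and j = j and N = N])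
       (use lin f j in blast)+
  from \<tau> show ?thesis
    unfolding disconnected_for_small_t_def
  proof (intro exI[of _ \<tau>] conjI ballI allI impI)
    fix t A
    assume "t \<in> {0<..<\<tau>}" and "compact A \<and> A \<noteq> {} \<and> hutchinson N f c t A = A"
    thus "\<not> connected A" by (intro dis[of t]) auto
  qed
qed

text \<open>
  Each magnification of a linear family replaces the common translation vector \<open>b\<close> by the vectors
  \<open>L\<^sub>i b\<close>. After at most \<open>k + 1\<close> of them the translation vectors are no longer all equal.
\<close>

lemma disconnected_for_small_t_if_orbit_splits:
  fixes L :: "nat \<Rightarrow> real^'n \<Rightarrow> real^'n"
  assumes lin: "\<And>i. i \<in> {1..N} \<Longrightarrow> linear (L i)"
    and j: "j \<in> {1..N}" "L j ((L 1 ^^ k) b) \<noteq> L 1 ((L 1 ^^ k) b)"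
  shows "disconnected_for_small_t N L (\<lambda>_. b)"
proof -
  have rescale: "disconnected_for_small_t N L (\<lambda>_. b)"
    if "disconnected_for_small_t N L (\<lambda>i. L i b)" for b
    by (rule disconnected_for_small_t_rescale[where L = L and a = "\<lambda>_. 0"]) (use lin that in auto)
  show ?thesis using j
  proof (induction k arbitrary: b j)
    case 0
    have "disconnected_for_small_t N L (\<lambda>i. L i b)"
      by (rule disconnected_for_small_t_if_translations_differ[where L = L and a = "\<lambda>_. 0" and j = j])
         (use lin 0 in auto)
    thus ?case by (rule rescale)
  next
    case (Suc k)
    show ?case
    proof (cases "\<exists>i\<in>{1..N}. L i b \<noteq> L 1 b")
      case True
      then obtain i where i: "i \<in> {1..N}" "L i b \<noteq> L 1 b" by blast
      have "disconnected_for_small_t N L (\<lambda>i. L i b)"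
        by (rule disconnected_for_small_t_if_translations_differ[where L = L and a = "\<lambda>_. 0" and j = i])
           (use lin i in auto)
      thus ?thesis by (rule rescale)
    next
      case False
      have "disconnected_for_small_t N L (\<lambda>_. L 1 b)"
      proof (rule Suc.IH[OF Suc.prems(1)])
        show "L j ((L 1 ^^ k) (L 1 b)) \<noteq> L 1 ((L 1 ^^ k) (L 1 b))"
          using Suc.prems(2) unfolding funpow_Suc_right o_apply .
      qed
      also have "?this \<longleftrightarrow> disconnected_for_small_t N L (\<lambda>i. L i b)"
      proof (rule disconnected_for_small_t_cong)
        show "L 1 b = L i b" if "i \<in> {1..N}" for i
          using False that by metis
      qed
      finally show ?thesis by (rule rescale)
    qed
  qed
qed

section \<open>A common fixed point in the remaining case\<close>

lemma linear_part_eq_matrix: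
  fixes f :: "real^'n \<Rightarrow> real^'n"
  assumes "linear L" "\<And>x. f x = L x + a"
  shows "linear_part f = matrix L"
  unfolding linear_part_def
proof (rule the_equality)
  show "\<exists>a. \<forall>x. f x = matrix L *v x + a" using assms by auto
  fix M assume "\<exists>a. \<forall>x. f x = M *v x + a"
  then obtain a' where a': "\<And>x. f x = M *v x + a'" by blast
  have "a = a'" using a'[of 0] assms(2)[of 0] linear_0[OF assms(1)] by simp
  hence "L = (*v) M" using a' assms(2) by (intro ext) (metis add_right_cancel)
  thus "M = matrix L" by simp
qed

text \<open>
  The \<open>k\<close>-fold repetition of the letter \<open>i\<close> has a matrix with eigenvalue \<open>(1 / t)\<^sup>k\<close>, so the joint
  spectral radius is at least \<open>1 / t\<close>.
\<close>

lemma existence_threshold_le_if_eigenvector: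
  fixes f :: "nat \<Rightarrow> real^'n \<Rightarrow> real^'n"
  assumes i: "i \<in> {1..N}" and t: "t > 0" and v: "v \<noteq> 0"
    and ev: "t *\<^sub>R (linear_part (f i) *v v) = v"
  shows "existence_threshold N f \<le> ereal t"
proof -
  define \<rho> where "\<rho> = joint_spectral_radius N f"
  define W where "W k = {w. length w = k \<and> set w \<subseteq> {1..N}}" for k
  have "1 / t \<le> root k (Max ((\<lambda>w. onorm ((*v) (word_matrix f w))) ` W k))" if k: "k > 0" for k
  proof -
    define Q where "Q = word_matrix f (replicate k i)"
    have step: "linear_part (f i) *v v = (1 / t) *\<^sub>R v"
      using ev t by (metis scaleR_scaleR scaleR_one nonzero_eq_divide_eq less_irrefl)
    have "word_matrix f (replicate m i) *v v = (1 / t) ^ m *\<^sub>R v" for m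
      by (induction m)
         (simp_all add: word_matrix_def step matrix_vector_mul_assoc[symmetric]
            matrix_vector_mult_scaleR)
    hence "norm (Q *v v) = (1 / t) ^ k * norm v" using t by (simp add: Q_def)
    hence "(1 / t) ^ k * norm v \<le> onorm ((*v) Q) * norm v"
      using onorm[OF matrix_vector_mul_bounded_linear, of Q v] by simp
    hence "(1 / t) ^ k \<le> onorm ((*v) Q)" using v by simp
    also have "\<dots> \<le> Max ((\<lambda>w. onorm ((*v) (word_matrix f w))) ` W k)"
    proof (rule Max_ge)
      have "finite (W k)"
        using finite_lists_length_eq[of "{1..N}" k] by (simp add: W_def conj_commute)
      thus "finite ((\<lambda>w. onorm ((*v) (word_matrix f w))) ` W k)" by simp
      have "replicate k i \<in> W k" using i by (auto simp: W_def)
      thus "onorm ((*v) Q) \<in> (\<lambda>w. onorm ((*v) (word_matrix f w))) ` W k"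
        unfolding Q_def by blast
    qed
    finally have "root k ((1 / t) ^ k) \<le> root k (Max ((\<lambda>w. onorm ((*v) (word_matrix f w))) ` W k))"
      using k by simp
    thus ?thesis using k t by (simp add: real_root_power_cancel)
  qed
  hence "ereal (1 / t) \<le> \<rho>"
    unfolding \<rho>_def joint_spectral_radius_def W_def
    by (intro le_Limsup eventually_sequentiallyI[of 1]) auto
  moreover have "1 / r \<le> t" if "1 / t \<le> r" for r
  proof -
    have "0 < 1 / t" using t by simp
    hence "0 < r" using that by linarith
    thus ?thesis using that t by (simp add: field_simps)
  qed
  ultimately show ?thesis
    unfolding existence_threshold_def \<rho>_def[symmetric] using t
    by (cases \<rho>) (auto simp: one_ereal_def)
qed

lemma common_fixed_point_imp_conjugate_to_linear:
  assumes "\<And>i. i \<in> {1..N} \<Longrightarrow> linear (L i)"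
    and "\<And>i x. i \<in> {1..N} \<Longrightarrow> f i x = L i x + a i"
    and "\<And>i. i \<in> {1..N} \<Longrightarrow> family_map f q i t p = p"
  shows "\<exists>h. \<forall>i\<in>{1..N}. \<exists>g. linear g \<and> conjugate_by h (family_map f q i t) g"
proof (intro exI ballI conjI)
  fix i assume i: "i \<in> {1..N}"
  show "linear (\<lambda>x. t *\<^sub>R L i x)"
    using assms(1)[OF i] by (rule linear_compose_scale_right)
  have "family_map f q i t (p + x) = p + t *\<^sub>R L i x" for x
    using assms(2)[OF i] assms(3)[OF i] linear_add[OF assms(1)[OF i], of p x]
    by (simp add: family_map_def algebra_simps)
  moreover have "inv ((+) p) = (\<lambda>x. x - p)"
    by (rule inv_unique_comp) auto
  ultimately show "conjugate_by ((+) p) (family_map f q i t) (\<lambda>x. t *\<^sub>R L i x)"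
    unfolding conjugate_by_def by (auto simp: bij_plus fun_eq_iff)
qed

lemma linear_inj_onto_invariant_subspace:
  fixes T :: "'a::euclidean_space \<Rightarrow> 'a"
  assumes "linear T" "inj T" "subspace V" "T ` V \<subseteq> V"
  shows "T ` V = V"
proof (rule subspace_dim_equal)
  have "inj_on T (span V)" using assms(2) by (rule inj_on_subset) simp
  thus "dim V \<le> dim (T ` V)" using dim_image_eq[OF assms(1), of V] by simp
qed (use assms linear_subspace_image in auto)

text \<open>
  With \<open>V\<close> the span of the orbit of \<open>b\<close> under \<open>L 1\<close>, the equation \<open>v - t L\<^sub>1 v = t b\<close> is solved inside
  \<open>V\<close>. The linear parts are known to agree only there, and a solution in \<open>V\<close> makes \<open>q0 + v\<close> a fixed
  point of every map and not just of the first one.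
\<close>

lemma quasi_linear_if_orbit_common:
  fixes f :: "nat \<Rightarrow> real^'n \<Rightarrow> real^'n"
  assumes N: "N \<ge> 1"
    and lin: "\<And>i. i \<in> {1..N} \<Longrightarrow> linear (L i)"
    and f: "\<And>i x. i \<in> {1..N} \<Longrightarrow> f i x = L i x + a i"
    and q: "\<And>i. i \<in> {1..N} \<Longrightarrow> q i = q0"
    and b: "\<And>i. i \<in> {1..N} \<Longrightarrow> f i q0 = b"
    and orbit: "\<And>i k. i \<in> {1..N} \<Longrightarrow> L i ((L 1 ^^ k) b) = L 1 ((L 1 ^^ k) b)"
  shows "quasi_linear N f q"
  unfolding quasi_linear_def
proof (intro allI impI)
  fix t assume t: "0 \<le> t" "ereal t < existence_threshold N f"
  have one: "1 \<in> {1..N}" using N by simp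
  note lin1 = lin[OF one]
  define S where "S = range (\<lambda>k. (L 1 ^^ k) b)"
  define T where "T x = x - t *\<^sub>R L 1 x" for x
  have linT: "linear T"
    unfolding T_def using lin1 by (intro linear_compose_sub linear_compose_scale_right linear_ident)
  have "v = 0" if "T v = 0" for v
  proof (rule ccontr)
    assume v: "v \<noteq> 0"
    have ev: "t *\<^sub>R (linear_part (f 1) *v v) = v"
      using that linear_part_eq_matrix[OF lin1 f[OF one]] lin1 by (simp add: T_def)
    hence "t \<noteq> 0" using v by auto
    thus False
      using existence_threshold_le_if_eigenvector[of 1 N t v f] one v ev t by simp
  qed
  hence inj: "inj T" using linT by (simp add: linear_injective_0)
  have "L 1 ` span S \<subseteq> span S"
  proof -
    have "L 1 ` S \<subseteq> S"
    proof (rule image_subsetI)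
      fix x assume "x \<in> S"
      then obtain k where "x = (L 1 ^^ k) b" by (auto simp: S_def)
      hence "L 1 x = (L 1 ^^ Suc k) b" by simp
      thus "L 1 x \<in> S" unfolding S_def by blast
    qed
    hence "span (L 1 ` S) \<subseteq> span S" by (rule span_mono)
    thus ?thesis using linear_span_image[OF lin1, of S] by simp
  qed
  hence L_span: "L 1 x \<in> span S" if "x \<in> span S" for x using that by blast
  have "T ` span S \<subseteq> span S"
  proof (rule image_subsetI)
    fix x assume "x \<in> span S"
    thus "T x \<in> span S" unfolding T_def using L_span by (intro span_diff span_scale)
  qed
  hence onto: "T ` span S = span S"
    by (rule linear_inj_onto_invariant_subspace[OF linT inj subspace_span])
  have "b \<in> S" unfolding S_def by (rule range_eqI[of _ _ 0]) simp
  hence "t *\<^sub>R b \<in> T ` span S" unfolding onto by (intro span_scale span_base)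
  then obtain v where v: "v \<in> span S" "T v = t *\<^sub>R b" by auto
  have "family_map f q i t (q0 + v) = q0 + v" if i: "i \<in> {1..N}" for i
  proof -
    have "L i x = L 1 x" if "x \<in> S" for x using that orbit[OF i] unfolding S_def by blast
    hence "L i v = L 1 v" by (rule linear_eq_on_span[OF lin[OF i] lin1 _ v(1)])
    moreover have "f i (q0 + v) = b + L i v"
      using f[OF i] b[OF i] linear_add[OF lin[OF i]] by (simp add: algebra_simps)
    ultimately show ?thesis
      using v(2) q[OF i] by (simp add: family_map_def T_def algebra_simps)
  qed
  thus "\<exists>h. \<forall>i\<in>{1..N}. \<exists>g. linear g \<and> conjugate_by h (family_map f q i t) g"
    by (intro common_fixed_point_imp_conjugate_to_linear[OF lin f])
qed

section \<open>Disconnected attractors\<close>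

text \<open>
  The disconnectedness criteria concern invariant sets, so the attractor is needed together with its
  invariance.
\<close>

lemma small_t_has_invariant_attractor:
  fixes f :: "nat \<Rightarrow> real^'n \<Rightarrow> real^'n"
  assumes N: "N \<ge> 1"
    and lin: "\<And>i. i \<in> {1..N} \<Longrightarrow> linear (L i)"
    and f: "\<And>i x. i \<in> {1..N} \<Longrightarrow> f i x = L i x + a i"
  shows "\<exists>\<tau>>0. \<forall>t. 0 \<le> t \<and> t < \<tau> \<longrightarrow>
    (\<exists>A. is_attractor N f q t A \<and> hutchinson N f q t A = A)"
proof -
  obtain M where M: "M > 0" and LM: "\<forall>i\<in>{1..N}. \<forall>x. norm (L i x) \<le> M * norm x"
    using finite_linear_common_bound[of "{1..N}" L] lin by auto
  note M = M LM[rule_format]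
  show ?thesis
  proof (intro exI[of _ "1 / M"] conjI allI impI)
    show "1 / M > 0" using M by simp
    fix t assume "0 \<le> t \<and> t < 1 / M"
    hence t: "0 \<le> t" "t < 1 / M" by blast+
    have r: "0 \<le> t * M" "t * M < 1" using t M by (auto simp: field_simps)
    have contr: "dist (family_map f q i t x) (family_map f q i t y) \<le> t * M * dist x y"
      if i: "i \<in> {1..N}" for i x y
    proof -
      have "family_map f q i t x - family_map f q i t y = t *\<^sub>R L i (x - y)"
        using f[OF i] linear_diff[OF lin[OF i], of x y]
        by (simp add: family_map_def flip: scaleR_diff_right)
      thus ?thesis
        using t(1) M(2)[OF i, of "x - y"] by (simp add: dist_norm mult.assoc mult_left_mono)
    qed
    have one: "1 \<in> {1..N}" using N by simp
    obtain A where A: "compact A" "A \<noteq> {}" "(\<Union>i\<in>{1..N}. family_map f q i t ` A) = A"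
      by (rule contractions_invariant_compact_exists[where g = "\<lambda>i. family_map f q i t",
            OF finite_atLeastAtMost one r]) (use contr in blast)+
    have H: "hutchinson N f q t = (\<lambda>K. \<Union>i\<in>{1..N}. family_map f q i t ` K)"
      by (simp add: fun_eq_iff hutchinson_def)
    have "is_attractor N f q t A"
      unfolding is_attractor_def H
    proof (intro conjI allI impI A(1,2))
      fix K :: "(real^'n) set" assume "compact K \<and> K \<noteq> {}"
      thus "(\<lambda>k. hausdorff_dist (((\<lambda>K. \<Union>i\<in>{1..N}. family_map f q i t ` K) ^^ k) K) A) \<longlonglongrightarrow> 0"
        by (intro contractions_iterates_tendsto_invariant[where r = "t * M"])
           (use r contr A in auto)
    qed
    thus "\<exists>A. is_attractor N f q t A \<and> hutchinson N f q t A = A"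
      using A(3) unfolding H by blast
  qed
qed

theorem theorem6p3:
  fixes f :: "nat \<Rightarrow> real^'n \<Rightarrow> real^'n" and q :: "nat \<Rightarrow> real^'n" and N :: nat
  assumes "one_parameter_affine_family N f q"
    and "\<not> quasi_linear N f q"
  shows "\<exists>\<tau>::real. \<tau> > 0 \<and>
    (\<forall>t\<in>{0..<\<tau>}. \<exists>A. is_attractor N f q t A \<and>
       (\<not> connected A \<or> (t = 0 \<and> (\<forall>i\<in>{1..N}. q i = q 1))))"
proof -
  have N: "N \<ge> 1" and aff: "\<And>i. i \<in> {1..N} \<Longrightarrow> affine_function (f i)"
    using assms(1) by (auto simp: one_parameter_affine_family_def)
  define a where "a i = f i 0" for i
  define L where "L i x = f i x - a i" for i x
  have f: "f i x = L i x + a i" for i x by (simp add: L_def)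
  have lin: "linear (L i)" if i: "i \<in> {1..N}" for i
  proof -
    obtain M b where "\<And>x. f i x = M *v x + b"
      using aff[OF i] unfolding affine_function_def by blast
    hence "L i = (*v) M" by (auto simp: L_def a_def)
    thus ?thesis by simp
  qed
  have "\<exists>\<sigma>>0. \<forall>t A. 0 \<le> t \<and> t < \<sigma> \<and> compact A \<and> A \<noteq> {} \<and> hutchinson N f q t A = A \<longrightarrow>
      \<not> connected A \<or> (t = 0 \<and> (\<forall>i\<in>{1..N}. q i = q 1))"
  proof (cases "\<forall>i\<in>{1..N}. q i = q 1")
    case False
    then obtain j where "j \<in> {1..N}" "q j \<noteq> q 1" by blast
    then obtain \<sigma> where "\<sigma> > 0" "\<And>t A. \<lbrakk>0 \<le> t; t < \<sigma>; compact A; A \<noteq> {};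
        hutchinson N f q t A = A\<rbrakk> \<Longrightarrow> \<not> connected A"
      using invariant_disconnected_if_translations_differ[of N L f a j q] lin f by blast
    thus ?thesis by blast
  next
    case True
    have dis: "disconnected_for_small_t N L (\<lambda>i. f i (q 1))"
    proof (cases "\<forall>i\<in>{1..N}. f i (q 1) = f 1 (q 1)")
      case False
      then obtain j where "j \<in> {1..N}" "f j (q 1) \<noteq> f 1 (q 1)" by blast
      thus ?thesis
        by (intro disconnected_for_small_t_if_translations_differ
              [where L = L and a = "\<lambda>_. 0" and j = j, OF lin]) simp_all
    next
      case common: True
      have "\<exists>j\<in>{1..N}. \<exists>k. L j ((L 1 ^^ k) (f 1 (q 1))) \<noteq> L 1 ((L 1 ^^ k) (f 1 (q 1)))"
      proof (rule ccontr)
        assume "\<not> ?thesis"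
        hence orbit: "L i ((L 1 ^^ k) (f 1 (q 1))) = L 1 ((L 1 ^^ k) (f 1 (q 1)))"
          if "i \<in> {1..N}" for i k
          using that by blast
        have "quasi_linear N f q"
        proof (rule quasi_linear_if_orbit_common[where L = L and a = a and ?q0.0 = "q 1"])
          show "q i = q 1" if "i \<in> {1..N}" for i using True that by blast
          show "f i (q 1) = f 1 (q 1)" if "i \<in> {1..N}" for i using common that by blast
          show "L i ((L 1 ^^ k) (f 1 (q 1))) = L 1 ((L 1 ^^ k) (f 1 (q 1)))" if "i \<in> {1..N}" for i k
            using orbit that .
        qed (use N lin f in simp_all)
        thus False using assms(2) by blast
      qed
      then obtain j k where jk: "j \<in> {1..N}"
          "L j ((L 1 ^^ k) (f 1 (q 1))) \<noteq> L 1 ((L 1 ^^ k) (f 1 (q 1)))"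
        by blast
      have "disconnected_for_small_t N L (\<lambda>_. f 1 (q 1))"
        by (rule disconnected_for_small_t_if_orbit_splits
              [where L = L and b = "f 1 (q 1)" and k = k, OF lin jk])
      also have "?this \<longleftrightarrow> disconnected_for_small_t N L (\<lambda>i. f i (q 1))"
        by (intro disconnected_for_small_t_cong bspec[OF common, symmetric])
      finally show ?thesis .
    qed
    have "disconnected_for_small_t N f (\<lambda>_. q 1)"
      by (rule disconnected_for_small_t_rescale
            [where L = L and f = f and a = a and c = "q 1", OF lin f dis])
    also have "?this \<longleftrightarrow> disconnected_for_small_t N f q"
      by (intro disconnected_for_small_t_cong bspec[OF True, symmetric])
    finally have "disconnected_for_small_t N f q" .
    then obtain \<sigma> where \<sigma>: "\<sigma> > 0" "\<forall>t\<in>{0<..<\<sigma>}. \<forall>A.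
        compact A \<and> A \<noteq> {} \<and> hutchinson N f q t A = A \<longrightarrow> \<not> connected A"
      unfolding disconnected_for_small_t_def by blast
    show ?thesis
    proof (intro exI[of _ \<sigma>] conjI allI impI)
      fix t A
      assume A: "0 \<le> t \<and> t < \<sigma> \<and> compact A \<and> A \<noteq> {} \<and> hutchinson N f q t A = A"
      show "\<not> connected A \<or> (t = 0 \<and> (\<forall>i\<in>{1..N}. q i = q 1))"
      proof (cases "t = 0")
        case t0: True
        thus ?thesis using True by blast
      next
        case False
        hence "t \<in> {0<..<\<sigma>}" using A by simp
        thus ?thesis using \<sigma>(2) A by blast
      qed
    qed (rule \<sigma>(1))
  qed
  then obtain \<sigma> where \<sigma>: "\<sigma> > 0" and dis: "\<forall>t A. 0 \<le> t \<and> t < \<sigma> \<and> compact A \<and> A \<noteq> {} \<and>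
      hutchinson N f q t A = A \<longrightarrow> \<not> connected A \<or> (t = 0 \<and> (\<forall>i\<in>{1..N}. q i = q 1))"
    by (elim exE conjE)
  have "\<exists>\<tau>>0. \<forall>t. 0 \<le> t \<and> t < \<tau> \<longrightarrow>
      (\<exists>A. is_attractor N f q t A \<and> hutchinson N f q t A = A)"
    by (rule small_t_has_invariant_attractor[where L = L and a = a, OF N lin f])
  then obtain \<tau> where \<tau>: "\<tau> > 0" and att: "\<forall>t. 0 \<le> t \<and> t < \<tau> \<longrightarrow>
      (\<exists>A. is_attractor N f q t A \<and> hutchinson N f q t A = A)"
    by (elim exE conjE)
  show ?thesis
  proof (intro exI[of _ "min \<sigma> \<tau>"] conjI ballI)
    show "min \<sigma> \<tau> > 0" using \<sigma> \<tau> by simp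
    fix t assume t: "t \<in> {0..<min \<sigma> \<tau>}"
    hence "\<exists>A. is_attractor N f q t A \<and> hutchinson N f q t A = A" using att by simp
    then obtain A where A: "is_attractor N f q t A" "hutchinson N f q t A = A" by blast
    note attractor = A(1)[unfolded is_attractor_def]
    have "compact A" "A \<noteq> {}" by (rule attractor[THEN conjunct1] attractor[THEN conjunct2, THEN conjunct1])+
    hence "0 \<le> t \<and> t < \<sigma> \<and> compact A \<and> A \<noteq> {} \<and> hutchinson N f q t A = A"
      using t A(2) by (intro conjI) simp_all
    hence "\<not> connected A \<or> (t = 0 \<and> (\<forall>i\<in>{1..N}. q i = q 1))"
      by (rule dis[THEN spec, THEN spec, THEN mp])
    with A(1) show "\<exists>A. is_attractor N f q t A \<and>
        (\<not> connected A \<or> (t = 0 \<and> (\<forall>i\<in>{1..N}. q i = q 1)))" by blast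
  qed
qed

end
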